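(* A measure $\mu$ on $\mathbb{N}$ is a density measure if and only if it is $\mathcal{G}$-invariant, i.e. $\mu(A)=\mu(\pi A)$ for all $A\subseteq\mathbb{N}$ and all permutations $\pi\in\mathcal{G}$.
   Context: $\mathbb{N}=\{1,2,3,\dots\}$. A measure on $\mathbb{N}$ is a function $\mu:\mathcal{P}(\mathbb{N})\to[0,1]$ with $\mu(\mathbb{N})=1$ and $\mu(A\cup B)=\mu(A)+\mu(B)$ for all disjoint $A,B\subseteq\mathbb{N}$. For $A\subseteq\mathbb{N}$ let $A(n)=|A\cap[1,n]|$ and $d(A)=\lim_{n\to\infty}A(n)/n$ when the limit exists (asymptotic density). A density measure is a measure $\mu$ on $\mathbb{N}$ with $\mu(A)=d(A)$ for every $A$ having asymptotic density. The Lévy group $\mathcal{G}$ is the group of all permutations $\pi$ of $\mathbb{N}$ such that $\lim_{n\to\infty}\frac{|\{k:\ k\le n<\pi(k)\}|}{n}=0$; $\pi A=\{\pi(a):a\in A\}$. *)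

theory Defs
  imports Complex_Main "HOL-Combinatorics.Permutations"
begin

text \<open>
  The positive integers are the set \<open>{1..} :: nat set\<close>.  A measure is a function on all of
  \<^typ>\<open>nat set\<close> of which only the values on subsets of \<open>{1..}\<close> are constrained or used.
\<close>

abbreviation pnat :: "nat set" ("\<nat>\<^sub>+")
  where "\<nat>\<^sub>+ \<equiv> {1..}"

definition measure_on_pnat :: "(nat set \<Rightarrow> real) \<Rightarrow> bool"
  where "measure_on_pnat \<mu> \<longleftrightarrow>
    (\<forall>A \<subseteq> \<nat>\<^sub>+. \<mu> A \<in> {0..1}) \<and>
    \<mu> \<nat>\<^sub>+ = 1 \<and>
    (\<forall>A \<subseteq> \<nat>\<^sub>+. \<forall>B \<subseteq> \<nat>\<^sub>+. A \<inter> B = {} \<longrightarrow> \<mu> (A \<union> B) = \<mu> A + \<mu> B)"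

definition counting :: "nat set \<Rightarrow> nat \<Rightarrow> nat"
  where "counting A n = card (A \<inter> {1..n})"

definition has_asymptotic_density :: "nat set \<Rightarrow> real \<Rightarrow> bool"
  where "has_asymptotic_density A d \<longleftrightarrow> (\<lambda>n. real (counting A n) / real n) \<longlonglongrightarrow> d"

definition density_measure :: "(nat set \<Rightarrow> real) \<Rightarrow> bool"
  where "density_measure \<mu> \<longleftrightarrow>
    measure_on_pnat \<mu> \<and>
    (\<forall>A \<subseteq> \<nat>\<^sub>+. \<forall>d. has_asymptotic_density A d \<longrightarrow> \<mu> A = d)"

text \<open>
  The carrier of the Levy group.  A permutation of \<open>\<nat>\<^sub>+\<close> is represented by its extension to
  \<^typ>\<open>nat\<close> that fixes \<open>0\<close>.
\<close>

definition Levy_group :: "(nat \<Rightarrow> nat) set"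
  where "Levy_group =
    {\<pi>. \<pi> permutes \<nat>\<^sub>+ \<and>
      (\<lambda>n. real (card {k \<in> \<nat>\<^sub>+. k \<le> n \<and> n < \<pi> k}) / real n) \<longlonglongrightarrow> 0}"

end

theory Submission
  imports Defs "HOL-Library.Infinite_Set" "HOL-Analysis.Elementary_Normed_Spaces"
begin

text \<open>
  Both directions pass through the relation \<open>A(n) - B(n) = o(n)\<close>.

  A Levy permutation changes every counting function only by \<open>o(n)\<close>.  If \<open>A\<close>, \<open>B\<close> are disjoint
  with \<open>A(n) - B(n) = o(n)\<close> and the complement of their union is split evenly into \<open>D\<close>, \<open>E\<close>,
  then \<open>A \<union> D\<close>, \<open>B \<union> D\<close> both have density \<open>1/2\<close>, so a density measure
  cannot distinguish \<open>A\<close> from \<open>B\<close>.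

  Conversely, if \<open>A\<close>, \<open>B\<close> have the same density in \<open>(0, 1)\<close>, the permutation mapping \<open>A\<close> to \<open>B\<close> and
  the complement of \<open>A\<close> to that of \<open>B\<close> monotonically is in the Levy group.  Hence an invariant
  measure takes the value \<open>p/q\<close> on all sets of density \<open>p/q\<close>, as on unions of \<open>p\<close> residue classes
  modulo \<open>q\<close>.  A set of density \<open>d\<close> contains subsets of every smaller density, so its measure is at
  least \<open>d\<close>, and the same bound for the complement gives equality.
\<close>

section \<open>Counting functions\<close>

lemma counting_0 [simp]: "counting A 0 = 0"
  by (simp add: counting_def)

lemma counting_Suc: "counting A (Suc n) = counting A n + (if Suc n \<in> A then 1 else 0)"
proof -
  have "A \<inter> {1..Suc n} = (if Suc n \<in> A then insert (Suc n) (A \<inter> {1..n}) else A \<inter> {1..n})"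
    by (auto simp: le_Suc_eq)
  then show ?thesis
    by (simp add: counting_def)
qed

lemma counting_pnat [simp]: "counting {Suc 0..} n = n"
  by (induction n) (simp_all add: counting_Suc)

lemma counting_Un_disjoint:
  "A \<inter> B = {} \<Longrightarrow> counting (A \<union> B) n = counting A n + counting B n"
  by (induction n) (auto simp: counting_Suc)

lemma counting_Diff_subset: "B \<subseteq> A \<Longrightarrow> counting (A - B) n + counting B n = counting A n"
  by (induction n) (auto simp: counting_Suc)

lemma counting_le_card: "finite A \<Longrightarrow> counting A n \<le> card A"
  by (simp add: counting_def card_mono)

section \<open>Asymptotic density: complements, disjoint unions and error bounds\<close>

lemma has_asymptotic_density_Compl:
  assumes "has_asymptotic_density A d" "A \<subseteq> \<nat>\<^sub>+"
  shows "has_asymptotic_density (\<nat>\<^sub>+ - A) (1 - d)"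
  unfolding has_asymptotic_density_def
proof (rule Lim_transform_eventually)
  show "(\<lambda>n. 1 - real (counting A n) / real n) \<longlonglongrightarrow> 1 - d"
    using assms(1) unfolding has_asymptotic_density_def by (intro tendsto_intros)
  \<comment> \<open>Division by zero yields 0, so at \<open>n = 0\<close> the left side is 1 and the
    right side 0; the identity holds only eventually.\<close>
  have "1 - real (counting A n) / real n = real (counting (\<nat>\<^sub>+ - A) n) / real n" if "n > 0" for n
    using counting_Diff_subset[OF assms(2), of n] that by (simp add: field_simps flip: of_nat_add)
  then show "\<forall>\<^sub>F n in sequentially.
      1 - real (counting A n) / real n = real (counting (\<nat>\<^sub>+ - A) n) / real n"
    using eventually_gt_at_top[of 0] by (rule eventually_mono[rotated])
qed

lemma has_asymptotic_density_Un_disjoint: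
  assumes "has_asymptotic_density A c" "has_asymptotic_density B d" "A \<inter> B = {}"
  shows "has_asymptotic_density (A \<union> B) (c + d)"
  using tendsto_add[OF assms(1,2)[unfolded has_asymptotic_density_def]] assms(3)
  by (simp add: has_asymptotic_density_def counting_Un_disjoint add_divide_distrib)

text \<open>Moves the work to undivided counts: errors from floors and from other sets can be added
  up by linear arithmetic before dividing by \<open>n\<close>.\<close>

lemma has_asymptotic_densityI_bounded:
  assumes "\<And>n. \<bar>real (counting A n) - d * real n\<bar> \<le> e n" "(\<lambda>n. e n / real n) \<longlonglongrightarrow> 0"
  shows "has_asymptotic_density A d"
  unfolding has_asymptotic_density_def
proof (rule LIM_zero_cancel, rule Lim_null_comparison[OF _ assms(2)])
  have "norm (real (counting A n) / real n - d) \<le> e n / real n" if "n > 0" for n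
  proof -
    have "real (counting A n) / real n - d = (real (counting A n) - d * real n) / real n"
      using that by (simp add: field_simps)
    then show ?thesis
      using assms(1)[of n] that by (simp add: divide_right_mono)
  qed
  then show "\<forall>\<^sub>F n in sequentially. norm (real (counting A n) / real n - d) \<le> e n / real n"
    using eventually_gt_at_top[of 0] by (rule eventually_mono[rotated])
qed

lemma has_asymptotic_density_finite:
  assumes "finite A"
  shows "has_asymptotic_density A 0"
  by (rule has_asymptotic_densityI_bounded[where e = "\<lambda>_. real (card A)"])
    (simp_all add: counting_le_card[OF assms] lim_const_over_n)

lemma has_asymptotic_density_positive_infinite:
  assumes "has_asymptotic_density A d" "d > 0"
  shows "infinite A"
proof
  assume "finite A"
  from has_asymptotic_density_finite[OF this] assms show False
    unfolding has_asymptotic_density_def using LIMSEQ_unique by fastforce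
qed

section \<open>Subsets of prescribed density\<close>

text \<open>The subset takes the elements of \<open>A\<close> at which \<open>\<lfloor>t * A(n)\<rfloor>\<close> jumps.\<close>

lemma exists_subset_counting_floor:
  fixes t :: real
  assumes "0 \<le> t" "t \<le> 1"
  obtains B where "B \<subseteq> A" "\<And>n. int (counting B n) = \<lfloor>t * real (counting A n)\<rfloor>"
proof
  define B where "B = {k \<in> A. \<lfloor>t * (real (counting A (k - 1)) + 1)\<rfloor> > \<lfloor>t * real (counting A (k - 1))\<rfloor>}"
  show "B \<subseteq> A"
    by (auto simp: B_def)
  show "int (counting B n) = \<lfloor>t * real (counting A n)\<rfloor>" for n
  proof (induction n)
    case 0
    then show ?case by simp
  next
    case (Suc n)
    define x where "x = t * real (counting A n)"
    \<comment> \<open>As \<open>t\<close> lies in \<open>[0, 1]\<close>, the floor rises by at most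
      1 per element of \<open>A\<close>, so including one element accounts for a whole jump.\<close>
    have "\<lfloor>x + t\<rfloor> = \<lfloor>x\<rfloor> \<or> \<lfloor>x + t\<rfloor> = \<lfloor>x\<rfloor> + 1"
      using assms by linarith
    moreover have "t * (real (counting A n) + 1) = x + t"
      by (simp add: x_def algebra_simps)
    ultimately show ?case
      using Suc by (auto simp: counting_Suc B_def x_def[symmetric] algebra_simps)
  qed
qed

text \<open>The floor construction keeps \<open>counting B n\<close> within 1 of
  \<open>t * counting A n\<close>; the rest of the error is \<open>t\<close> times the error of
  \<open>A\<close> itself.\<close>

lemma exists_subset_density:
  fixes t :: real
  assumes "0 \<le> t" "t \<le> 1" "has_asymptotic_density A d"
  obtains B where "B \<subseteq> A" "has_asymptotic_density B (t * d)"
proof -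
  obtain B where B: "B \<subseteq> A" "\<And>n. int (counting B n) = \<lfloor>t * real (counting A n)\<rfloor>"
    using exists_subset_counting_floor[OF assms(1,2)] by blast
  have "has_asymptotic_density B (t * d)"
  proof (rule has_asymptotic_densityI_bounded)
    fix n
    have "real (counting B n) = of_int \<lfloor>t * real (counting A n)\<rfloor>"
      by (metis B(2) of_int_of_nat_eq)
    then have "\<bar>real (counting B n) - t * real (counting A n)\<bar> \<le> 1"
      by linarith
    moreover have "\<bar>t * real (counting A n) - t * d * real n\<bar> = t * \<bar>real (counting A n) - d * real n\<bar>"
      using assms(1) by (simp add: abs_mult mult.assoc flip: right_diff_distrib)
    ultimately show "\<bar>real (counting B n) - t * d * real n\<bar> \<le> 1 + t * \<bar>real (counting A n) - d * real n\<bar>"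
      by linarith
  next
    have "(\<lambda>n. 1 / real n + t * \<bar>real (counting A n) / real n - d\<bar>) \<longlonglongrightarrow> 0 + t * \<bar>d - d\<bar>"
      using assms(3) unfolding has_asymptotic_density_def
      by (intro tendsto_intros lim_const_over_n)
    moreover have "1 / real n + t * \<bar>real (counting A n) / real n - d\<bar> =
        (1 + t * \<bar>real (counting A n) - d * real n\<bar>) / real n" if "n > 0" for n
    proof -
      have "real (counting A n) / real n - d = (real (counting A n) - d * real n) / real n"
        using that by (simp add: field_simps)
      then show ?thesis
        by (simp add: add_divide_distrib)
    qed
    ultimately show "(\<lambda>n. (1 + t * \<bar>real (counting A n) - d * real n\<bar>) / real n) \<longlonglongrightarrow> 0"
      by (auto elim!: Lim_transform_eventually intro!: eventually_mono[OF eventually_gt_at_top[of 0]])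
  qed
  with B(1) show thesis
    by (rule that)
qed

section \<open>Measures\<close>

lemma measure_on_pnat_Un_disjoint:
  "measure_on_pnat \<mu> \<Longrightarrow> A \<subseteq> \<nat>\<^sub>+ \<Longrightarrow> B \<subseteq> \<nat>\<^sub>+ \<Longrightarrow> A \<inter> B = {} \<Longrightarrow> \<mu> (A \<union> B) = \<mu> A + \<mu> B"
  by (simp add: measure_on_pnat_def)

lemma measure_on_pnat_nonneg: "measure_on_pnat \<mu> \<Longrightarrow> A \<subseteq> \<nat>\<^sub>+ \<Longrightarrow> 0 \<le> \<mu> A"
  by (simp add: measure_on_pnat_def)

lemma measure_on_pnat_empty: "measure_on_pnat \<mu> \<Longrightarrow> \<mu> {} = 0"
  using measure_on_pnat_Un_disjoint[of \<mu> "{}" "{}"] by simp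

lemma measure_on_pnat_mono:
  assumes "measure_on_pnat \<mu>" "A \<subseteq> B" "B \<subseteq> \<nat>\<^sub>+"
  shows "\<mu> A \<le> \<mu> B"
proof -
  have "\<mu> (A \<union> (B - A)) = \<mu> A + \<mu> (B - A)"
    using assms by (intro measure_on_pnat_Un_disjoint) auto
  moreover have "A \<union> (B - A) = B" "0 \<le> \<mu> (B - A)"
    using assms by (auto intro!: measure_on_pnat_nonneg[OF assms(1)])
  ultimately show ?thesis
    by simp
qed

lemma measure_on_pnat_Compl:
  assumes "measure_on_pnat \<mu>" "A \<subseteq> \<nat>\<^sub>+"
  shows "\<mu> (\<nat>\<^sub>+ - A) = 1 - \<mu> A"
proof -
  have "\<mu> (A \<union> (\<nat>\<^sub>+ - A)) = \<mu> A + \<mu> (\<nat>\<^sub>+ - A)"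
    using assms by (intro measure_on_pnat_Un_disjoint) auto
  moreover have "A \<union> (\<nat>\<^sub>+ - A) = \<nat>\<^sub>+"
    using assms by auto
  ultimately show ?thesis
    using assms(1) by (simp add: measure_on_pnat_def)
qed

section \<open>Density measures are invariant\<close>

lemma density_measure_eq_disjoint:
  assumes "density_measure \<mu>" "A \<subseteq> \<nat>\<^sub>+" "B \<subseteq> \<nat>\<^sub>+" "A \<inter> B = {}"
    and "(\<lambda>n. (real (counting A n) - real (counting B n)) / real n) \<longlonglongrightarrow> 0"
  shows "\<mu> A = \<mu> B"
proof -
  define C where "C = \<nat>\<^sub>+ - (A \<union> B)"
  \<comment> \<open>Since \<open>C\<close> has \<open>n - A(n) - B(n)\<close> elements up to
    \<open>n\<close>, adding half of them to \<open>A\<close> gives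
    \<open>n/2 + (A(n) - B(n))/2\<close> up to rounding, and symmetrically for
    \<open>B\<close>.\<close>
  obtain D where D: "D \<subseteq> C" "\<And>n. int (counting D n) = \<lfloor>(1 / 2) * real (counting C n)\<rfloor>"
    using exists_subset_counting_floor[of "1 / 2" C] by auto
  have sub: "A \<union> D \<subseteq> \<nat>\<^sub>+" "B \<union> D \<subseteq> \<nat>\<^sub>+" "D \<subseteq> \<nat>\<^sub>+"
    and disj: "A \<inter> D = {}" "B \<inter> D = {}"
    using D(1) assms by (auto simp: C_def)
  \<comment> \<open>One error term for both unions: the difference of the counts, plus 1 for the
    rounding in \<open>D\<close>.\<close>
  let ?e = "\<lambda>n. \<bar>real (counting A n) - real (counting B n)\<bar> + 1"
  have "(\<lambda>n. \<bar>(real (counting A n) - real (counting B n)) / real n\<bar> + 1 / real n) \<longlonglongrightarrow> 0"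
    using tendsto_add[OF tendsto_rabs[OF assms(5)] lim_const_over_n[of 1]] by simp
  then have e: "(\<lambda>n. ?e n / real n) \<longlonglongrightarrow> 0"
    by (simp add: add_divide_distrib)
  have count: "counting C n + counting A n + counting B n = n"
      "real (counting D n) \<le> real (counting C n) / 2"
      "real (counting D n) > real (counting C n) / 2 - 1" for n
  proof -
    show "counting C n + counting A n + counting B n = n"
      using counting_Diff_subset[of "A \<union> B" "\<nat>\<^sub>+" n] assms(2-4)
      by (simp add: C_def counting_Un_disjoint)
    have "real (counting D n) = of_int \<lfloor>(1 / 2) * real (counting C n)\<rfloor>"
      by (metis D(2) of_int_of_nat_eq)
    then show "real (counting D n) \<le> real (counting C n) / 2"
        "real (counting D n) > real (counting C n) / 2 - 1"
      by linarith+
  qed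
  have count': "real (counting C n) + real (counting A n) + real (counting B n) = real n" for n
    using count(1)[of n] by linarith
  have "has_asymptotic_density (A \<union> D) (1 / 2)"
  proof (rule has_asymptotic_densityI_bounded[OF _ e])
    fix n show "\<bar>real (counting (A \<union> D) n) - 1 / 2 * real n\<bar> \<le> ?e n"
      using count(2,3)[of n] count'[of n] disj by (simp add: counting_Un_disjoint)
  qed
  moreover have "has_asymptotic_density (B \<union> D) (1 / 2)"
  proof (rule has_asymptotic_densityI_bounded[OF _ e])
    fix n show "\<bar>real (counting (B \<union> D) n) - 1 / 2 * real n\<bar> \<le> ?e n"
      using count(2,3)[of n] count'[of n] disj by (simp add: counting_Un_disjoint)
  qed
  ultimately have "\<mu> (A \<union> D) = \<mu> (B \<union> D)"
    using assms(1) sub unfolding density_measure_def by metis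
  moreover have "\<mu> (A \<union> D) = \<mu> A + \<mu> D" "\<mu> (B \<union> D) = \<mu> B + \<mu> D"
    using assms(1-3) sub disj by (auto simp: density_measure_def intro!: measure_on_pnat_Un_disjoint)
  ultimately show ?thesis
    by simp
qed

text \<open>The common part \<open>A \<inter> B\<close> contributes equally to both counts and to
  both measures, which reduces the claim to the disjoint sets \<open>A - B\<close> and
  \<open>B - A\<close>.\<close>

lemma density_measure_eq:
  assumes "density_measure \<mu>" "A \<subseteq> \<nat>\<^sub>+" "B \<subseteq> \<nat>\<^sub>+"
    and "(\<lambda>n. (real (counting A n) - real (counting B n)) / real n) \<longlonglongrightarrow> 0"
  shows "\<mu> A = \<mu> B"
proof -
  have m: "measure_on_pnat \<mu>"
    using assms(1) by (simp add: density_measure_def)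
  have split: "counting X n = counting (X - Y) n + counting (X \<inter> Y) n" for X Y :: "nat set" and n
    by (induction n) (auto simp: counting_Suc)
  have "real (counting (A - B) n) - real (counting (B - A) n) =
      real (counting A n) - real (counting B n)" for n
    using split[of A n B] split[of B n A] by (simp add: Int_commute)
  then have "\<mu> (A - B) = \<mu> (B - A)"
    using assms by (intro density_measure_eq_disjoint) auto
  moreover have "\<mu> X = \<mu> (X - Y) + \<mu> (X \<inter> Y)" if "X \<subseteq> \<nat>\<^sub>+" for X Y
    using measure_on_pnat_Un_disjoint[OF m, of "X - Y" "X \<inter> Y"] that
    by (simp add: Un_Diff_Int Diff_Int_distrib2 le_infI1 subset_iff)
  ultimately show ?thesis
    using assms(2,3) by (metis Int_commute)
qed

section \<open>Counting functions under permutations\<close>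

text \<open>The change in the count is the number of elements leaving \<open>{1..n}\<close> minus
  the number entering it. Both are bounded by the corresponding numbers for the whole space, and
  those two agree.\<close>

lemma counting_image_permutes_le:
  assumes "\<pi> permutes \<nat>\<^sub>+" "A \<subseteq> \<nat>\<^sub>+"
  shows "\<bar>real (counting A n) - real (counting (\<pi> ` A) n)\<bar> \<le>
    real (card {k \<in> \<nat>\<^sub>+. k \<le> n \<and> n < \<pi> k})"
proof -
  have inj: "inj \<pi>"
    using assms(1) by (rule permutes_inj)
  have pos: "\<pi> k \<ge> 1 \<longleftrightarrow> k \<ge> 1" for k
    using permutes_in_image[OF assms(1), of k] by simp
  \<comment> \<open>The entering elements exceed \<open>n\<close> without an explicit bound;
    injectivity makes them finite, so that their \<open>card\<close> is meaningful.\<close>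
  have fin: "finite {k. \<pi> k \<le> n}"
    using finite_vimageI[OF finite_atMost inj, of n] by (simp add: vimage_def)
  have decomp: "real (counting X n) - real (counting (\<pi> ` X) n) =
      real (card {k \<in> X. k \<le> n \<and> n < \<pi> k}) - real (card {k \<in> X. \<pi> k \<le> n \<and> n < k})"
    if "X \<subseteq> \<nat>\<^sub>+" for X
  proof -
    let ?both = "{k \<in> X. k \<le> n \<and> \<pi> k \<le> n}"
    have "X \<inter> {1..n} = ?both \<union> {k \<in> X. k \<le> n \<and> n < \<pi> k}"
      using that by auto
    moreover have "card (?both \<union> {k \<in> X. k \<le> n \<and> n < \<pi> k}) =
        card ?both + card {k \<in> X. k \<le> n \<and> n < \<pi> k}"
      by (rule card_Un_disjoint) auto
    moreover have "\<pi> ` X \<inter> {1..n} = \<pi> ` (?both \<union> {k \<in> X. \<pi> k \<le> n \<and> n < k})"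
      using that pos by auto
    moreover have "card (?both \<union> {k \<in> X. \<pi> k \<le> n \<and> n < k}) =
        card ?both + card {k \<in> X. \<pi> k \<le> n \<and> n < k}"
      by (rule card_Un_disjoint) (auto intro: finite_subset[OF _ fin])
    ultimately show ?thesis
      by (simp add: counting_def card_image inj_on_subset[OF inj])
  qed
  \<comment> \<open>The image of the whole space is the space itself, so its count does not change:
    as many points enter \<open>{1..n}\<close> as leave it.\<close>
  have "card {k \<in> \<nat>\<^sub>+. \<pi> k \<le> n \<and> n < k} = card {k \<in> \<nat>\<^sub>+. k \<le> n \<and> n < \<pi> k}"
    using decomp[of "\<nat>\<^sub>+"] permutes_image[OF assms(1)] by simp
  moreover have "card {k \<in> A. k \<le> n \<and> n < \<pi> k} \<le> card {k \<in> \<nat>\<^sub>+. k \<le> n \<and> n < \<pi> k}"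
    using assms(2) by (intro card_mono) auto
  moreover have "card {k \<in> A. \<pi> k \<le> n \<and> n < k} \<le> card {k \<in> \<nat>\<^sub>+. \<pi> k \<le> n \<and> n < k}"
    using assms(2) by (intro card_mono) (auto intro: finite_subset[OF _ fin])
  ultimately show ?thesis
    using decomp[OF assms(2)] by linarith
qed

lemma density_measure_Levy_invariant:
  assumes "density_measure \<mu>" "A \<subseteq> \<nat>\<^sub>+" "\<pi> \<in> Levy_group"
  shows "\<mu> A = \<mu> (\<pi> ` A)"
proof (rule density_measure_eq[OF assms(1,2)])
  have p: "\<pi> permutes \<nat>\<^sub>+"
    and lim: "(\<lambda>n. real (card {k \<in> \<nat>\<^sub>+. k \<le> n \<and> n < \<pi> k}) / real n) \<longlonglongrightarrow> 0"
    using assms(3) by (auto simp: Levy_group_def)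
  show "\<pi> ` A \<subseteq> \<nat>\<^sub>+"
    using assms(2) permutes_image[OF p] by blast
  show "(\<lambda>n. (real (counting A n) - real (counting (\<pi> ` A) n)) / real n) \<longlonglongrightarrow> 0"
    using counting_image_permutes_le[OF p assms(2)]
    by (intro Lim_null_comparison[OF _ lim] always_eventually) (simp add: divide_right_mono)
qed

section \<open>Invariant measures are density measures\<close>

text \<open>Elements of equal rank are matched: \<open>?g\<close> sends an element of
  \<open>A\<close> to its index in the increasing enumeration of \<open>A\<close>.\<close>

lemma exists_monotone_bij_betw:
  fixes A B :: "nat set"
  assumes "infinite A" "infinite B"
  obtains f where "bij_betw f A B" "strict_mono_on A f"
proof
  let ?g = "inv_into UNIV (enumerate A)"
  have bA: "bij_betw (enumerate A) UNIV A" and bB: "bij_betw (enumerate B) UNIV B"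
    using assms by (simp_all add: bij_enumerate)
  show "bij_betw (enumerate B \<circ> ?g) A B"
    using bij_betw_inv_into[OF bA] bB by (rule bij_betw_trans)
  show "strict_mono_on A (enumerate B \<circ> ?g)"
  proof (rule strict_mono_onI)
    fix x y assume "x \<in> A" "y \<in> A" "x < y"
    then have "enumerate A (?g x) < enumerate A (?g y)"
      using bij_betw_inv_into_right[OF bA] by simp
    then show "(enumerate B \<circ> ?g) x < (enumerate B \<circ> ?g) y"
      using assms by simp
  qed
qed

text \<open>Once some \<open>k \<le> n\<close> is sent beyond \<open>n\<close>, monotonicity sends
  all later elements beyond \<open>n\<close> too. Nothing then enters from above, and the number of
  crossings is exactly \<open>counting A n - counting B n\<close>.\<close>

lemma card_monotone_bij_crossing_le:
  assumes "bij_betw f A B" "strict_mono_on A f" "A \<subseteq> \<nat>\<^sub>+" "B \<subseteq> \<nat>\<^sub>+"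
  shows "real (card {k \<in> A. k \<le> n \<and> n < f k}) \<le> \<bar>real (counting A n) - real (counting B n)\<bar>"
proof (cases "{k \<in> A. k \<le> n \<and> n < f k} = {}")
  case True
  then show ?thesis by (simp only: card.empty)
next
  case False
  then obtain k where k: "k \<in> A" "k \<le> n" "n < f k"
    by auto
  have inj: "inj_on f A" and im: "f ` A = B"
    using assms(1) by (auto simp: bij_betw_def)
  \<comment> \<open>A preimage \<open>a\<close> of some \<open>b \<le> n\<close> must lie below the
    crossing element \<open>k\<close>, hence below \<open>n\<close>.\<close>
  have sub: "B \<inter> {1..n} \<subseteq> f ` (A \<inter> {1..n})"
  proof
    fix b assume b: "b \<in> B \<inter> {1..n}"
    then obtain a where a: "a \<in> A" "b = f a"
      using im by auto
    have "\<not> k < a" "k \<noteq> a"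
      using strict_mono_onD[OF assms(2) k(1) a(1)] k(3) b a(2) by auto
    then show "b \<in> f ` (A \<inter> {1..n})"
      using a k(2) assms(3) by auto
  qed
  have "f ` {k \<in> A. k \<le> n \<and> n < f k} = f ` (A \<inter> {1..n}) - B \<inter> {1..n}"
    using im assms(3,4) by fastforce
  moreover have "card (f ` {k \<in> A. k \<le> n \<and> n < f k}) = card {k \<in> A. k \<le> n \<and> n < f k}"
      "card (f ` (A \<inter> {1..n})) = counting A n"
    by (auto simp: counting_def intro!: card_image inj_on_subset[OF inj])
  ultimately have "card {k \<in> A. k \<le> n \<and> n < f k} = counting A n - counting B n"
    using card_Diff_subset[OF _ sub] by (simp add: counting_def)
  then show ?thesis
    by linarith
qed

lemma exists_Levy_permutation:
  assumes "A \<subseteq> \<nat>\<^sub>+" "B \<subseteq> \<nat>\<^sub>+"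
    and "infinite A" "infinite B" "infinite (\<nat>\<^sub>+ - A)" "infinite (\<nat>\<^sub>+ - B)"
    and lim: "(\<lambda>n. (real (counting A n) - real (counting B n)) / real n) \<longlonglongrightarrow> 0"
  obtains \<pi> where "\<pi> \<in> Levy_group" "\<pi> ` A = B"
proof -
  obtain f where f: "bij_betw f A B" "strict_mono_on A f"
    using exists_monotone_bij_betw assms by blast
  obtain g where g: "bij_betw g (\<nat>\<^sub>+ - A) (\<nat>\<^sub>+ - B)" "strict_mono_on (\<nat>\<^sub>+ - A) g"
    using exists_monotone_bij_betw assms by blast
  \<comment> \<open>The last branch concerns only 0, which \<open>permutes\<close> requires to be
    fixed.\<close>
  define \<pi> where "\<pi> k = (if k \<in> A then f k else if k \<in> \<nat>\<^sub>+ then g k else k)" for k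
  have eqf: "\<pi> k = f k" if "k \<in> A" for k
    using that by (simp add: \<pi>_def)
  have eqg: "\<pi> k = g k" if "k \<in> \<nat>\<^sub>+ - A" for k
    using that by (simp add: \<pi>_def)
  have bA: "bij_betw \<pi> A B"
    using f(1) bij_betw_cong[of A \<pi> f] eqf by blast
  have bC: "bij_betw \<pi> (\<nat>\<^sub>+ - A) (\<nat>\<^sub>+ - B)"
    using g(1) bij_betw_cong[of "\<nat>\<^sub>+ - A" \<pi> g] eqg by blast
  have "bij_betw \<pi> (A \<union> (\<nat>\<^sub>+ - A)) (B \<union> (\<nat>\<^sub>+ - B))"
    using bij_betw_combine[OF bA bC] by blast
  moreover have "A \<union> (\<nat>\<^sub>+ - A) = \<nat>\<^sub>+" "B \<union> (\<nat>\<^sub>+ - B) = \<nat>\<^sub>+"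
    using assms(1,2) by auto
  ultimately have p: "\<pi> permutes \<nat>\<^sub>+"
    using assms(1) by (intro bij_imp_permutes) (auto simp: \<pi>_def)
  \<comment> \<open>The factor 2 collects the crossings of \<open>f\<close> and of \<open>g\<close>:
    the counts of the complements differ by the same amount as those of \<open>A\<close> and
    \<open>B\<close>.\<close>
  have bound: "real (card {k \<in> \<nat>\<^sub>+. k \<le> n \<and> n < \<pi> k}) \<le>
      2 * \<bar>real (counting A n) - real (counting B n)\<bar>" for n
  proof -
    have "{k \<in> \<nat>\<^sub>+. k \<le> n \<and> n < \<pi> k} =
        {k \<in> A. k \<le> n \<and> n < f k} \<union> {k \<in> \<nat>\<^sub>+ - A. k \<le> n \<and> n < g k}"
      using assms(1) by (auto simp: \<pi>_def split: if_splits)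
    then have "real (card {k \<in> \<nat>\<^sub>+. k \<le> n \<and> n < \<pi> k}) \<le>
        real (card {k \<in> A. k \<le> n \<and> n < f k}) + real (card {k \<in> \<nat>\<^sub>+ - A. k \<le> n \<and> n < g k})"
      by (simp only: card_Un_le of_nat_le_iff flip: of_nat_add)
    moreover have "real (card {k \<in> A. k \<le> n \<and> n < f k}) \<le>
        \<bar>real (counting A n) - real (counting B n)\<bar>"
      by (rule card_monotone_bij_crossing_le[OF f assms(1,2)])
    moreover have "real (card {k \<in> \<nat>\<^sub>+ - A. k \<le> n \<and> n < g k}) \<le>
        \<bar>real (counting (\<nat>\<^sub>+ - A) n) - real (counting (\<nat>\<^sub>+ - B) n)\<bar>"
      by (rule card_monotone_bij_crossing_le[OF g]) auto
    moreover have "real (counting (\<nat>\<^sub>+ - X) n) = real n - real (counting X n)"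
      if "X \<subseteq> \<nat>\<^sub>+" for X
      using counting_Diff_subset[OF that, of n] by (simp add: eq_diff_eq flip: of_nat_add)
    then have "\<bar>real (counting (\<nat>\<^sub>+ - A) n) - real (counting (\<nat>\<^sub>+ - B) n)\<bar> =
        \<bar>real (counting A n) - real (counting B n)\<bar>"
      using assms(1,2) by (simp only: diff_diff_eq2 diff_add_cancel)
    ultimately show ?thesis
      by argo
  qed
  have "(\<lambda>n. 2 * \<bar>(real (counting A n) - real (counting B n)) / real n\<bar>) \<longlonglongrightarrow> 0"
    using tendsto_mult_left[OF tendsto_rabs[OF lim], of 2] by simp
  then have "(\<lambda>n. real (card {k \<in> \<nat>\<^sub>+. k \<le> n \<and> n < \<pi> k}) / real n) \<longlonglongrightarrow> 0"
  proof (rule Lim_null_comparison[rotated], intro always_eventually allI)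
    fix n
    show "norm (real (card {k \<in> \<nat>\<^sub>+. k \<le> n \<and> n < \<pi> k}) / real n) \<le>
        2 * \<bar>(real (counting A n) - real (counting B n)) / real n\<bar>"
      using divide_right_mono[OF bound[of n], of "real n"] by simp
  qed
  with p have "\<pi> \<in> Levy_group"
    by (simp add: Levy_group_def)
  moreover have "\<pi> ` A = B"
    using bA by (simp add: bij_betw_def)
  ultimately show thesis
    by (rule that)
qed

definition Levy_invariant :: "(nat set \<Rightarrow> real) \<Rightarrow> bool"
  where "Levy_invariant \<mu> \<longleftrightarrow> (\<forall>A \<subseteq> \<nat>\<^sub>+. \<forall>\<pi> \<in> Levy_group. \<mu> A = \<mu> (\<pi> ` A))"

text \<open>The strict bounds on \<open>d\<close> make both sets and both complements infinite, so
  that the two monotone bijections exist.\<close>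

lemma Levy_invariant_same_density:
  assumes "Levy_invariant \<mu>" "A \<subseteq> \<nat>\<^sub>+" "B \<subseteq> \<nat>\<^sub>+"
    and dens: "has_asymptotic_density A d" "has_asymptotic_density B d" and "0 < d" "d < 1"
  shows "\<mu> A = \<mu> B"
proof -
  have "(\<lambda>n. (real (counting A n) - real (counting B n)) / real n) \<longlonglongrightarrow> 0"
    using tendsto_diff[OF dens[unfolded has_asymptotic_density_def]] by (simp add: diff_divide_distrib)
  moreover have "infinite A" "infinite B" "infinite (\<nat>\<^sub>+ - A)" "infinite (\<nat>\<^sub>+ - B)"
    using dens has_asymptotic_density_Compl[OF dens(1) assms(2)]
      has_asymptotic_density_Compl[OF dens(2) assms(3)] \<open>0 < d\<close> \<open>d < 1\<close>
    by (simp_all only: has_asymptotic_density_positive_infinite diff_gt_0_iff_gt not_False_eq_True)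
  ultimately obtain \<pi> where "\<pi> \<in> Levy_group" "\<pi> ` A = B"
    using exists_Levy_permutation assms(2,3) by blast
  then show ?thesis
    using assms(1,2) by (auto simp: Levy_invariant_def)
qed

section \<open>Residue classes and rational densities\<close>

definition residue_class :: "nat \<Rightarrow> nat \<Rightarrow> nat set"
  where "residue_class q i = {n \<in> \<nat>\<^sub>+. n mod q = i}"

text \<open>The quotient counts the \<open>k\<close> in \<open>{0..n}\<close> with
  \<open>k mod q = i\<close>; the extra 1 for \<open>i = 0\<close> stands for \<open>k = 0\<close>,
  which is not a positive integer.\<close>

lemma counting_residue_class:
  assumes "i < q"
  shows "counting (residue_class q i) n + (if i = 0 then 1 else 0) = (n + q - i) div q"
proof (induction n)
  case 0
  then show ?case using assms by simp
next
  case (Suc n)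
  \<comment> \<open>The quotient jumps exactly when \<open>q\<close> divides the new numerator.
    Passing to \<open>int\<close> avoids truncated subtraction.\<close>
  have "Suc (n + q - i) mod q = 0 \<longleftrightarrow> Suc n mod q = i"
  proof -
    have "int (Suc (n + q - i)) = (int (Suc n) - int i) + int q"
      using assms by simp
    then have "int q dvd int (Suc (n + q - i)) \<longleftrightarrow> int q dvd int (Suc n) - int i"
      by (simp only: dvd_add_triv_right_iff)
    also have "\<dots> \<longleftrightarrow> int (Suc n) mod int q = int i mod int q"
      by (simp only: mod_eq_dvd_iff)
    also have "\<dots> \<longleftrightarrow> Suc n mod q = i"
      using assms by (simp only: zmod_int[symmetric] of_nat_eq_iff mod_less)
    finally show ?thesis
      by (simp only: int_dvd_int_iff flip: dvd_eq_mod_eq_0)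
  qed
  moreover have "Suc n + q - i = Suc (n + q - i)"
    using assms by simp
  ultimately show ?case
    using Suc by (simp add: counting_Suc residue_class_def div_Suc)
qed

lemma has_asymptotic_density_residue_class:
  assumes "i < q"
  shows "has_asymptotic_density (residue_class q i) (1 / real q)"
proof (rule has_asymptotic_densityI_bounded)
  \<comment> \<open>A crude 3: at most 1 each for the floor, for the shift \<open>1 - i / q\<close>
    and for the uncounted 0.\<close>
  show "(\<lambda>n. 3 / real n) \<longlonglongrightarrow> 0"
    by (rule lim_const_over_n)
  fix n
  have "real ((n + q - i) div q) = of_int \<lfloor>real (n + q - i) / real q\<rfloor>"
    by (simp add: floor_divide_of_nat_eq)
  then have "real ((n + q - i) div q) \<le> real (n + q - i) / real q"
      "real (n + q - i) / real q - 1 < real ((n + q - i) div q)"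
    by linarith+
  moreover have "real (n + q - i) / real q = real n / real q + 1 - real i / real q"
    using assms by (simp add: of_nat_diff field_simps)
  moreover have "0 \<le> real i / real q" "real i / real q \<le> 1"
    using assms by simp_all
  moreover have "real (counting (residue_class q i) n) \<le> real ((n + q - i) div q)"
      "real ((n + q - i) div q) \<le> real (counting (residue_class q i) n) + 1"
    using counting_residue_class[OF assms, of n] by (simp_all split: if_splits)
  moreover have "1 / real q * real n = real n / real q"
    by simp
  ultimately show "\<bar>real (counting (residue_class q i) n) - 1 / real q * real n\<bar> \<le> 3"
    by linarith
qed

lemma Levy_invariant_rational_density:
  assumes m: "measure_on_pnat \<mu>" and "Levy_invariant \<mu>" "A \<subseteq> \<nat>\<^sub>+"
    and "0 < p" "p < q" "has_asymptotic_density A (real p / real q)"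
  shows "\<mu> A = real p / real q"
proof -
  \<comment> \<open>\<open>U r\<close> is the union of the first \<open>r\<close> residue classes:
    \<open>U q\<close> is everything and fixes the measure of one class, while \<open>U p\<close> is
    the reference set to compare with \<open>A\<close>.\<close>
  define U where "U r = {n \<in> \<nat>\<^sub>+. n mod q < r}" for r
  have U_Suc: "U (Suc r) = U r \<union> residue_class q r" "U r \<inter> residue_class q r = {}" for r
    by (auto simp: U_def residue_class_def)
  \<comment> \<open>From \<open>0 < p < q\<close> follows \<open>q > 1\<close>, so the common
    density \<open>1 / q\<close> lies strictly between 0 and 1.\<close>
  have eq: "\<mu> (residue_class q i) = \<mu> (residue_class q 0)" if "i < q" for i
    using assms that
    by (intro Levy_invariant_same_density[where d = "1 / real q"] has_asymptotic_density_residue_class)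
      (auto simp: residue_class_def)
  have U: "\<mu> (U r) = real r * \<mu> (residue_class q 0) \<and> has_asymptotic_density (U r) (real r / real q)"
    if "r \<le> q" for r
    using that
  proof (induction r)
    case 0
    then show ?case
      using m by (simp add: U_def measure_on_pnat_empty has_asymptotic_density_finite)
  next
    case (Suc r)
    have "\<mu> (U (Suc r)) = \<mu> (U r) + \<mu> (residue_class q r)"
      unfolding U_Suc(1)
      by (rule measure_on_pnat_Un_disjoint[OF m]) (auto simp: U_def residue_class_def)
    moreover have "has_asymptotic_density (U (Suc r)) (real r / real q + 1 / real q)"
      unfolding U_Suc(1) using Suc U_Suc(2)
      by (intro has_asymptotic_density_Un_disjoint has_asymptotic_density_residue_class) auto
    ultimately show ?case
      using Suc eq[of r] by (simp add: algebra_simps add_divide_distrib)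
  qed
  have "U q = \<nat>\<^sub>+"
    using assms(5) by (auto simp: U_def)
  then have "real q * \<mu> (residue_class q 0) = 1"
    using U[of q] m by (simp add: measure_on_pnat_def)
  then have "\<mu> (U p) = real p / real q"
    using U[of p] assms(5) by (simp add: field_simps)
  moreover have "\<mu> A = \<mu> (U p)"
    using assms U[of p]
    by (intro Levy_invariant_same_density[where d = "real p / real q"]) (auto simp: U_def)
  ultimately show ?thesis
    by simp
qed

section \<open>From rational to real densities\<close>

lemma has_asymptotic_density_le_1:
  assumes "has_asymptotic_density A d"
  shows "d \<le> 1"
proof -
  have "counting A n \<le> n" for n
    by (induction n) (auto simp: counting_Suc)
  then have "real (counting A n) / real n \<le> 1" for n
    by (simp add: divide_le_eq)
  then show ?thesis
    using assms unfolding has_asymptotic_density_def by (blast intro: LIMSEQ_le_const2)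
qed

text \<open>A rational \<open>s\<close> strictly between \<open>\<mu> A\<close> and \<open>d\<close>
  would be the density, hence the measure, of some subset of \<open>A\<close>, against
  monotonicity.\<close>

lemma Levy_invariant_ge_density:
  assumes m: "measure_on_pnat \<mu>" and "Levy_invariant \<mu>" "A \<subseteq> \<nat>\<^sub>+" "has_asymptotic_density A d"
  shows "d \<le> \<mu> A"
proof (rule ccontr)
  assume "\<not> d \<le> \<mu> A"
  then obtain s where s: "s \<in> \<rat>" "\<mu> A < s" "s < d"
    using Rats_dense_in_real[of "\<mu> A" d] by auto
  have "0 < s"
    using s measure_on_pnat_nonneg[OF m assms(3)] by simp
  have "s < 1"
    using s has_asymptotic_density_le_1[OF assms(4)] by simp
  obtain p q where "q \<noteq> 0" and pq: "\<bar>s\<bar> = real p / real q"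
    using Rats_abs_nat_div_natE[OF s(1)] by blast
  then have s_eq: "s = real p / real q"
    using \<open>0 < s\<close> by simp
  have "0 < p" "p < q"
    using \<open>0 < s\<close> \<open>s < 1\<close> \<open>q \<noteq> 0\<close> by (auto simp: s_eq zero_less_divide_iff divide_less_eq)
  \<comment> \<open>The proportion \<open>s / d\<close> is below 1 and thins \<open>A\<close> from
    density \<open>d\<close> to \<open>s\<close>.\<close>
  obtain B where B: "B \<subseteq> A" "has_asymptotic_density B (s / d * d)"
    using exists_subset_density[of "s / d" A d] assms(4) \<open>0 < s\<close> s by auto
  have "\<mu> B = s"
    unfolding s_eq
    using B assms s \<open>0 < s\<close> \<open>0 < p\<close> \<open>p < q\<close>
    by (intro Levy_invariant_rational_density) (auto simp flip: s_eq)
  then show False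
    using measure_on_pnat_mono[OF m B(1) assms(3)] s by simp
qed

theorem theorem2p6:
  fixes \<mu> :: "nat set \<Rightarrow> real"
  assumes "measure_on_pnat \<mu>"
  shows "density_measure \<mu> \<longleftrightarrow> (\<forall>A \<subseteq> \<nat>\<^sub>+. \<forall>\<pi> \<in> Levy_group. \<mu> A = \<mu> (\<pi> ` A))"
proof
  assume "density_measure \<mu>"
  then show "\<forall>A \<subseteq> \<nat>\<^sub>+. \<forall>\<pi> \<in> Levy_group. \<mu> A = \<mu> (\<pi> ` A)"
    using density_measure_Levy_invariant by blast
next
  assume "\<forall>A \<subseteq> \<nat>\<^sub>+. \<forall>\<pi> \<in> Levy_group. \<mu> A = \<mu> (\<pi> ` A)"
  then have inv: "Levy_invariant \<mu>"
    by (simp add: Levy_invariant_def)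
  have "\<mu> A = d" if A: "A \<subseteq> \<nat>\<^sub>+" "has_asymptotic_density A d" for A d
  proof (rule antisym)
    \<comment> \<open>Complementation turns this lower bound into the upper bound on
      \<open>\<mu> A\<close>.\<close>
    have "1 - d \<le> \<mu> (\<nat>\<^sub>+ - A)"
      using has_asymptotic_density_Compl[OF A(2,1)]
      by (intro Levy_invariant_ge_density[OF assms inv]) auto
    then show "\<mu> A \<le> d"
      using measure_on_pnat_Compl[OF assms A(1)] by simp
    show "d \<le> \<mu> A"
      by (rule Levy_invariant_ge_density[OF assms inv A])
  qed
  then show "density_measure \<mu>"
    using assms by (simp add: density_measure_def)
qed

end
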